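(* Let $K$ be a field, $S=K[x_1,\ldots,x_n]$, let $I\subset S$ be a monomial ideal and let $v\in S$ be a monomial. Then $$\operatorname{slength}(I:v)\leq\operatorname{slength}(I).$$ The equality holds if $I=v(I:v)$.
   Context: Let $M$ be a finitely generated $\mathbb Z^n$-graded $S$-module, $S=K[x_1,\ldots,x_n]$. A Stanley decomposition of $M$ is a finite direct sum of $K$-vector spaces $\mathcal D: M=\bigoplus_{i=1}^r m_iK[Z_i]$, where each $m_i\in M$ is homogeneous, $Z_i\subset\{x_1,\ldots,x_n\}$, and $m_iK[Z_i]$ is a free $K[Z_i]$-module. Its length is $\operatorname{slength}(\mathcal D)=r$, and the Stanley length of $M$ is $\operatorname{slength}(M)=\min\{\operatorname{slength}(\mathcal D):\mathcal D\text{ is a Stanley decomposition of }M\}$. The zero module has the empty Stanley decomposition, so $\operatorname{slength}(0)=0$. $(I:v)=\{f\in S: fv\in I\}$. *)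

theory Defs
  imports Complex_Main "HOL-Library.Poly_Mapping" "HOL-Library.FuncSet" "HOL-Library.Extended_Nat"
begin

text \<open>The variables are indexed by a finite type 'n with n elements. An exponent vector is a
  \<^typ>\<open>'n \<Rightarrow>\<^sub>0 nat\<close>, and a polynomial is a finitely supported map from exponent vectors to
  coefficients, with the convolution product of \<^theory>\<open>HOL-Library.Poly_Mapping\<close>.\<close>

type_synonym ('n, 'k) mpoly = "('n \<Rightarrow>\<^sub>0 nat) \<Rightarrow>\<^sub>0 'k"

definition monom :: "('n \<Rightarrow>\<^sub>0 nat) \<Rightarrow> ('n, 'k::field) mpoly" where
  "monom t = Poly_Mapping.single t 1"

text \<open>The subring K[Z] for a set Z of (indices of) variables.\<close>

definition poly_ring_on :: "'n set \<Rightarrow> ('n, 'k::field) mpoly set" where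
  "poly_ring_on Z = {f. \<forall>t \<in> Poly_Mapping.keys f. Poly_Mapping.keys t \<subseteq> Z}"

text \<open>The fine grading of S by integer vectors; the component in degree a is 0 if a has a
  negative entry.\<close>

definition fine_component :: "('n \<Rightarrow> int) \<Rightarrow> ('n, 'k::field) mpoly set" where
  "fine_component a =
    {f. \<forall>t \<in> Poly_Mapping.keys f. \<forall>i. int (Poly_Mapping.lookup t i) = a i}"

text \<open>An S-module is given by its scalar multiplication \<open>scl\<close> and a grading by its components
  \<open>G a\<close>. The set M is a graded submodule of the ambient graded module, with
  components \<open>M \<inter> G a\<close>, so that no separate type is needed for an ideal of S.\<close>

definition stanley_space ::
    "(('n, 'k::field) mpoly \<Rightarrow> 'm \<Rightarrow> 'm) \<Rightarrow> 'm \<times> 'n set \<Rightarrow> 'm set" where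
  "stanley_space scl p = (\<lambda>f. scl f (fst p)) ` poly_ring_on (snd p)"

text \<open>A pair (m, Z) in the list D stands for the summand m K[Z]. It is free over K[Z] on m iff
  f \<open>\<mapsto>\<close> f m is injective on K[Z] (in particular m is nonzero). The sum of the summands
  is direct and equal to M iff addition is a bijection from their product onto M. The length
  is the number of list entries.\<close>

definition stanley_decomposition ::
    "(('n, 'k::field) mpoly \<Rightarrow> 'm::ab_group_add \<Rightarrow> 'm) \<Rightarrow> (('n \<Rightarrow> int) \<Rightarrow> 'm set) \<Rightarrow> 'm set \<Rightarrow>
      ('m \<times> 'n set) list \<Rightarrow> bool" where
  "stanley_decomposition scl G M D \<longleftrightarrow>
    (\<forall>(m, Z) \<in> set D.
      m \<in> M \<and> (\<exists>a. m \<in> G a) \<and> inj_on (\<lambda>f. scl f m) (poly_ring_on Z)) \<and>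
    bij_betw (\<lambda>u. \<Sum>i<length D. u i)
      (\<Pi>\<^sub>E i\<in>{..<length D}. stanley_space scl (D ! i)) M"

text \<open>The infimum is a minimum whenever a Stanley decomposition exists, as it does for every
  finitely generated graded module; it is \<open>\<infinity>\<close> otherwise.\<close>

definition slength ::
    "(('n, 'k::field) mpoly \<Rightarrow> 'm::ab_group_add \<Rightarrow> 'm) \<Rightarrow> (('n \<Rightarrow> int) \<Rightarrow> 'm set) \<Rightarrow> 'm set \<Rightarrow> enat"
  where
  "slength scl G M = (INF D \<in> {D. stanley_decomposition scl G M D}. enat (length D))"

abbreviation ideal_slength :: "('n, 'k::field) mpoly set \<Rightarrow> enat" where
  "ideal_slength I \<equiv> slength (*) fine_component I"

definition monomial_ideal :: "('n, 'k::field) mpoly set \<Rightarrow> bool" where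
  "monomial_ideal I \<longleftrightarrow> (\<exists>A. I = module.span (*) (monom ` A))"

definition colon_ideal ::
    "('n, 'k::field) mpoly set \<Rightarrow> ('n, 'k) mpoly \<Rightarrow> ('n, 'k) mpoly set" where
  "colon_ideal I v = {f. f * v \<in> I}"

end

theory Submission
  imports Defs "HOL-Library.Disjoint_Sets"
begin

text \<open>A monomial ideal is spanned by the monomials with exponents in a set \<open>E\<close>, and its Stanley
  decompositions of length \<open>r\<close> correspond to the partitions of \<open>E\<close> into \<open>r\<close> translated orthants
  \<open>s + \<nat>\<^sup>Z\<close>. Passing from \<open>I\<close> to \<open>(I : x\<^sup>t)\<close> replaces each of them by its preimage under
  translation by \<open>t\<close>, which is empty or again a translated orthant. If \<open>I = x\<^sup>t (I : x\<^sup>t)\<close>, then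
  \<open>E\<close> is the translate by \<open>t\<close> of the exponent set of \<open>(I : x\<^sup>t)\<close>, and partitions can be
  translated back.\<close>

section \<open>Coordinate subspaces, orthants and partitions into orthants\<close>

definition supported_on :: "'a set \<Rightarrow> ('a \<Rightarrow>\<^sub>0 'b::zero) set" where
  "supported_on A = {f. Poly_Mapping.keys f \<subseteq> A}"

definition orthant :: "('n \<Rightarrow>\<^sub>0 nat) \<times> 'n set \<Rightarrow> ('n \<Rightarrow>\<^sub>0 nat) set" where
  "orthant p = (+) (fst p) ` {u. Poly_Mapping.keys u \<subseteq> snd p}"

text \<open>A list rather than a set of pairs, so that its length is the number of pieces and
  \<open>map\<close> and \<open>filter\<close> act on it directly. \<open>sorted_wrt\<close>
  compares entries by position; as orthants are nonempty, a repeated entry is excluded.\<close>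

definition orthant_partition :: "(('n \<Rightarrow>\<^sub>0 nat) \<times> 'n set) list \<Rightarrow> ('n \<Rightarrow>\<^sub>0 nat) set \<Rightarrow> bool" where
  "orthant_partition L E \<longleftrightarrow>
    sorted_wrt (\<lambda>p q. disjnt (orthant p) (orthant q)) L \<and> (\<Union>p\<in>set L. orthant p) = E"

section \<open>Multiplication by a single term\<close>

lemma sum_single_lookup: "(\<Sum>k\<in>Poly_Mapping.keys f. Poly_Mapping.single k (Poly_Mapping.lookup f k)) = f"
proof (rule poly_mapping_eqI)
  fix j
  show "Poly_Mapping.lookup (\<Sum>k\<in>Poly_Mapping.keys f. Poly_Mapping.single k (Poly_Mapping.lookup f k)) j
      = Poly_Mapping.lookup f j"
    by (cases "j \<in> Poly_Mapping.keys f")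
      (auto simp: lookup_sum lookup_single when_def in_keys_iff sum.delta')
qed

text \<open>Cancellation makes \<open>k + s\<close> determine \<open>k\<close>, so exactly one term
  of \<open>f\<close> can contribute to this coefficient.\<close>

lemma lookup_mult_single:
  fixes f :: "'a::cancel_comm_monoid_add \<Rightarrow>\<^sub>0 'b::comm_semiring_0"
  shows "Poly_Mapping.lookup (f * Poly_Mapping.single s c) (k + s) = Poly_Mapping.lookup f k * c"
proof -
  have "f * Poly_Mapping.single s c =
      (\<Sum>j\<in>Poly_Mapping.keys f. Poly_Mapping.single (j + s) (Poly_Mapping.lookup f j * c))"
    by (subst sum_single_lookup[of f, symmetric]) (simp add: sum_distrib_right mult_single)
  then show ?thesis
    by (cases "k \<in> Poly_Mapping.keys f")
      (auto simp: lookup_sum lookup_single when_def in_keys_iff sum.delta)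
qed

lemma keys_mult_single:
  fixes f :: "'a::cancel_comm_monoid_add \<Rightarrow>\<^sub>0 'b::field"
  assumes "c \<noteq> 0"
  shows "Poly_Mapping.keys (f * Poly_Mapping.single s c) = (\<lambda>k. k + s) ` Poly_Mapping.keys f"
proof
  show "Poly_Mapping.keys (f * Poly_Mapping.single s c) \<subseteq> (\<lambda>k. k + s) ` Poly_Mapping.keys f"
    using keys_mult[of f "Poly_Mapping.single s c"] assms by auto
  show "(\<lambda>k. k + s) ` Poly_Mapping.keys f \<subseteq> Poly_Mapping.keys (f * Poly_Mapping.single s c)"
    using assms by (auto simp: in_keys_iff lookup_mult_single)
qed

lemma inj_mult_single:
  fixes s :: "'a::cancel_comm_monoid_add" and c :: "'b::field"
  assumes "c \<noteq> 0"
  shows "inj (\<lambda>f. f * Poly_Mapping.single s c)"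
proof (rule injI, rule poly_mapping_eqI)
  fix f g :: "'a \<Rightarrow>\<^sub>0 'b" and k
  assume "f * Poly_Mapping.single s c = g * Poly_Mapping.single s c"
  then have "Poly_Mapping.lookup f k * c = Poly_Mapping.lookup g k * c"
    by (metis lookup_mult_single)
  then show "Poly_Mapping.lookup f k = Poly_Mapping.lookup g k"
    using assms by simp
qed

section \<open>Homogeneous generators and the spaces they span\<close>

text \<open>Multiplying by the generator translates supports by \<open>s\<close>. Conversely, every
  term with exponent in the orthant is divisible by the generator, with quotient in
  \<open>K[Z]\<close>, because \<open>c\<close> is invertible.\<close>

lemma stanley_space_single:
  fixes s :: "'n \<Rightarrow>\<^sub>0 nat" and c :: "'k::field"
  assumes "c \<noteq> 0"
  shows "stanley_space (*) (Poly_Mapping.single s c, Z) = supported_on (orthant (s, Z))"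
proof
  show "stanley_space (*) (Poly_Mapping.single s c, Z) \<subseteq> supported_on (orthant (s, Z))"
    using assms
    by (auto simp: stanley_space_def supported_on_def orthant_def keys_mult_single
        poly_ring_on_def add.commute[of s])
next
  show "supported_on (orthant (s, Z)) \<subseteq> stanley_space (*) (Poly_Mapping.single s c, Z)"
  proof
    fix g :: "('n, 'k) mpoly"
    assume "g \<in> supported_on (orthant (s, Z))"
    \<comment> \<open>Subtraction of exponents is truncated; it is genuine here because
      \<open>k\<close> lies in the orthant based at \<open>s\<close>.\<close>
    have k: "k - s + s = k \<and> Poly_Mapping.keys (k - s) \<subseteq> Z"
      if "k \<in> Poly_Mapping.keys g" for k
    proof -
      obtain u where "k = s + u" "Poly_Mapping.keys u \<subseteq> Z"
        using \<open>g \<in> supported_on _\<close> \<open>k \<in> Poly_Mapping.keys g\<close> by (auto simp: supported_on_def orthant_def)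
      then show ?thesis by (simp add: add.commute)
    qed
    \<comment> \<open>The quotient of \<open>g\<close> by the generator, formed term by
      term.\<close>
    define f where "f = (\<Sum>k\<in>Poly_Mapping.keys g.
      Poly_Mapping.single (k - s) (Poly_Mapping.lookup g k / c))"
    have "f * Poly_Mapping.single s c = g"
      unfolding f_def sum_distrib_right mult_single
      by (rule trans[OF _ sum_single_lookup]) (use assms k in \<open>auto intro!: sum.cong\<close>)
    moreover have "f \<in> poly_ring_on Z"
    proof -
      have "Poly_Mapping.keys f \<subseteq> (\<lambda>k. k - s) ` Poly_Mapping.keys g"
        unfolding f_def by (rule order_trans[OF keys_sum]) (auto split: if_splits)
      then show ?thesis using k by (auto simp: poly_ring_on_def)
    qed
    ultimately show "g \<in> stanley_space (*) (Poly_Mapping.single s c, Z)"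
      by (auto simp: stanley_space_def)
  qed
qed

text \<open>A degree fixes every entry of the exponent, so a fine component has dimension at most
  one.\<close>

lemma homogeneous_eq_single:
  assumes "m \<in> fine_component a" "m \<noteq> 0"
  obtains s c where "m = Poly_Mapping.single s c" "c \<noteq> 0"
proof -
  from assms(2) obtain s where s: "s \<in> Poly_Mapping.keys m"
    by (metis all_not_in_conv keys_eq_empty)
  have "t = s" if "t \<in> Poly_Mapping.keys m" for t
  proof (rule poly_mapping_eqI)
    fix i
    have "int (Poly_Mapping.lookup t i) = int (Poly_Mapping.lookup s i)"
      using assms(1) s that by (simp add: fine_component_def)
    then show "Poly_Mapping.lookup t i = Poly_Mapping.lookup s i" by simp
  qed
  with s have "Poly_Mapping.keys m = {s}" by blast
  then have "m = Poly_Mapping.single s (Poly_Mapping.lookup m s)"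
    using sum_single_lookup[of m] by simp
  then show ?thesis
    by (rule that) (use s in \<open>simp add: in_keys_iff\<close>)
qed

lemma single_in_fine_component:
  "Poly_Mapping.single s c \<in> fine_component (\<lambda>i. int (Poly_Mapping.lookup s i))"
  by (simp add: fine_component_def)

section \<open>Direct sums of coordinate subspaces\<close>

text \<open>This turns the linear condition of a direct sum into the combinatorial one of a
  partition. From left to right, it suffices to test the bijection on single monomials; from right
  to left, each coordinate in \<open>E\<close> belongs to exactly one summand.\<close>

lemma bij_betw_sum_supported_on_iff:
  fixes B :: "nat \<Rightarrow> 'a set"
  shows "bij_betw (\<lambda>u. \<Sum>i<r. u i)
      (\<Pi>\<^sub>E i\<in>{..<r}. (supported_on (B i) :: ('a \<Rightarrow>\<^sub>0 'b::{ab_group_add,zero_neq_one}) set)) (supported_on E)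
    \<longleftrightarrow> disjoint_family_on B {..<r} \<and> (\<Union>i<r. B i) = E" (is "?bij \<longleftrightarrow> ?part")
proof
  assume bij: ?bij
  \<comment> \<open>The tuple with the monomial of exponent \<open>b\<close> in slot
    \<open>i\<close> and 0 in the other slots. The restriction to \<open>{..<r}\<close> makes it an
    element of the extensional product.\<close>
  define e :: "nat \<Rightarrow> 'a \<Rightarrow> nat \<Rightarrow> 'a \<Rightarrow>\<^sub>0 'b" where
    "e i b = (\<lambda>j\<in>{..<r}. if j = i then Poly_Mapping.single b 1 else 0)" for i b
  have e: "e i b \<in> (\<Pi>\<^sub>E i\<in>{..<r}. supported_on (B i))" if "b \<in> B i" for i b
    using that by (auto simp: e_def supported_on_def)
  have sum_e: "(\<Sum>j<r. e i b j) = Poly_Mapping.single b 1" if "i < r" for i b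
    using that by (simp add: e_def)
  have "B i \<subseteq> E" if "i < r" for i
  proof
    fix b assume "b \<in> B i"
    from bij_betw_apply[OF bij e[OF this]] show "b \<in> E"
      using that by (simp add: sum_e supported_on_def)
  qed
  \<comment> \<open>Surjectivity writes the monomial of exponent \<open>b\<close> as a sum, and
    \<open>b\<close> must occur in the support of some summand.\<close>
  moreover have "b \<in> (\<Union>i<r. B i)" if "b \<in> E" for b
  proof -
    have "Poly_Mapping.single b (1::'b) \<in> supported_on E"
      using that by (simp add: supported_on_def)
    then obtain u where u: "u \<in> (\<Pi>\<^sub>E i\<in>{..<r}. supported_on (B i))"
        "Poly_Mapping.single b (1::'b) = (\<Sum>i<r. u i)"
      using bij_betw_imp_surj_on[OF bij] by blast
    have "b \<in> Poly_Mapping.keys (\<Sum>i<r. u i)"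
      by (simp flip: u(2))
    then show ?thesis
      using u(1) keys_sum[of u "{..<r}"] by (fastforce simp: supported_on_def PiE_iff)
  qed
  moreover have "disjoint_family_on B {..<r}"
    unfolding disjoint_family_on_def
  \<comment> \<open>For \<open>b\<close> in both sets, the monomial could be placed in slot
    \<open>i\<close> or in slot \<open>j\<close> with the same sum, against injectivity: slot
    \<open>i\<close> has coefficient 1 at \<open>b\<close> in one tuple and 0 in the other.\<close>
  proof (intro ballI impI, rule ccontr)
    fix i j assume ij: "i \<in> {..<r}" "j \<in> {..<r}" "i \<noteq> j" and "B i \<inter> B j \<noteq> {}"
    then obtain b where b: "b \<in> B i" "b \<in> B j" by blast
    have "e i b = e j b"
      by (rule inj_onD[OF bij_betw_imp_inj_on[OF bij] _ e[OF b(1)] e[OF b(2)]])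
        (use ij in \<open>simp add: sum_e\<close>)
    from arg_cong[OF fun_cong[OF this, of i], of "\<lambda>f. Poly_Mapping.lookup f b"] ij show False
      by (simp add: e_def)
  qed
  ultimately show ?part by blast
next
  assume part: ?part
  \<comment> \<open>Disjointness keeps \<open>k\<close> out of the supports of all other summands,
    so the coefficients of the \<open>i\<close>-th one can be read off from the sum.\<close>
  have lookup_sum_PiE: "Poly_Mapping.lookup (\<Sum>j<r. u j) k = Poly_Mapping.lookup (u i) k"
    if "u \<in> (\<Pi>\<^sub>E i\<in>{..<r}. supported_on (B i))" "i < r" "k \<in> B i" for u :: "nat \<Rightarrow> 'a \<Rightarrow>\<^sub>0 'b" and i k
  proof -
    have "Poly_Mapping.lookup (u j) k = 0" if "j < r" "j \<noteq> i" for j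
    proof -
      have "k \<notin> B j"
        using part that \<open>i < r\<close> \<open>k \<in> B i\<close> by (auto simp: disjoint_family_on_def)
      then show ?thesis
        using \<open>u \<in> _\<close> \<open>j < r\<close> by (auto simp: supported_on_def PiE_iff simp flip: not_in_keys_iff_lookup_eq_zero)
    qed
    then have "(\<Sum>j<r. Poly_Mapping.lookup (u j) k) =
        (\<Sum>j<r. if j = i then Poly_Mapping.lookup (u j) k else 0)"
      by (intro sum.cong) auto
    then show ?thesis using \<open>i < r\<close> by (simp add: lookup_sum)
  qed
  show ?bij
    unfolding bij_betw_def
  proof (intro conjI inj_onI)
    fix u w :: "nat \<Rightarrow> 'a \<Rightarrow>\<^sub>0 'b"
    assume u: "u \<in> (\<Pi>\<^sub>E i\<in>{..<r}. supported_on (B i))"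
      and w: "w \<in> (\<Pi>\<^sub>E i\<in>{..<r}. supported_on (B i))"
      and eq: "(\<Sum>i<r. u i) = (\<Sum>i<r. w i)"
    show "u = w"
    proof (rule PiE_ext[OF u w], rule poly_mapping_eqI)
      fix i k assume "i \<in> {..<r}"
      show "Poly_Mapping.lookup (u i) k = Poly_Mapping.lookup (w i) k"
      proof (cases "k \<in> B i")
        case True
        then show ?thesis
          using \<open>i \<in> {..<r}\<close> u w eq lookup_sum_PiE by (metis lessThan_iff)
      next
        case False
        then have "k \<notin> Poly_Mapping.keys (u i)" "k \<notin> Poly_Mapping.keys (w i)"
          using u w \<open>i \<in> {..<r}\<close> by (auto simp: supported_on_def PiE_iff)
        then show ?thesis by (simp add: in_keys_iff)
      qed
    qed
  next
    show "(\<lambda>u. \<Sum>i<r. u i) ` (\<Pi>\<^sub>E i\<in>{..<r}. supported_on (B i) :: ('a \<Rightarrow>\<^sub>0 'b) set) = supported_on E"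
    proof (intro equalityI subsetI)
      fix f :: "'a \<Rightarrow>\<^sub>0 'b" assume "f \<in> (\<lambda>u. \<Sum>i<r. u i) ` (\<Pi>\<^sub>E i\<in>{..<r}. supported_on (B i))"
      then obtain u where u: "u \<in> (\<Pi>\<^sub>E i\<in>{..<r}. supported_on (B i))" "f = (\<Sum>i<r. u i)"
        by blast
      then show "f \<in> supported_on E"
        using part keys_sum[of u "{..<r}"] by (fastforce simp: supported_on_def PiE_iff)
    next
      fix f :: "'a \<Rightarrow>\<^sub>0 'b" assume f: "f \<in> supported_on E"
      \<comment> \<open>A preimage of \<open>f\<close>: its terms are sorted into the slots
        according to the \<open>B i\<close> containing their exponents.\<close>
      define w where "w = (\<lambda>i\<in>{..<r}. \<Sum>k\<in>Poly_Mapping.keys f \<inter> B i.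
        Poly_Mapping.single k (Poly_Mapping.lookup f k))"
      have w: "w \<in> (\<Pi>\<^sub>E i\<in>{..<r}. supported_on (B i))"
        unfolding w_def supported_on_def
        by (auto dest!: subsetD[OF keys_sum] split: if_splits)
      have lookup_w: "Poly_Mapping.lookup (w i) k = Poly_Mapping.lookup f k"
        if "i < r" "k \<in> B i" for i k
        using that by (cases "k \<in> Poly_Mapping.keys f")
          (auto simp: w_def lookup_sum lookup_single when_def in_keys_iff sum.delta')
      have "(\<Sum>i<r. w i) = f"
      proof (rule poly_mapping_eqI)
        fix k
        show "Poly_Mapping.lookup (\<Sum>i<r. w i) k = Poly_Mapping.lookup f k"
        proof (cases "k \<in> E")
          case True
          then obtain i where "i < r" "k \<in> B i" using part by blast
          then show ?thesis by (simp add: lookup_sum_PiE[OF w] lookup_w)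
        next
          case False
          then have "k \<notin> Poly_Mapping.keys (\<Sum>i<r. w i)"
            using part w keys_sum[of w "{..<r}"] by (fastforce simp: supported_on_def PiE_iff)
          moreover have "k \<notin> Poly_Mapping.keys f"
            using False f by (auto simp: supported_on_def)
          ultimately show ?thesis by (simp add: in_keys_iff)
        qed
      qed
      then show "f \<in> (\<lambda>u. \<Sum>i<r. u i) ` (\<Pi>\<^sub>E i\<in>{..<r}. supported_on (B i))"
        using w by blast
    qed
  qed
qed

section \<open>Stanley decompositions as orthant partitions\<close>

text \<open>Links the list form, suited to \<open>map\<close> and \<open>filter\<close>, with the
  indexed form in which direct sums are stated. Symmetry of disjointness accounts for
  \<open>sorted_wrt\<close> looking at each pair in one order only.\<close>

lemma orthant_partition_iff_nth:
  "orthant_partition L E \<longleftrightarrow>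
    disjoint_family_on (\<lambda>i. orthant (L ! i)) {..<length L} \<and> (\<Union>i<length L. orthant (L ! i)) = E"
proof -
  have "sorted_wrt (\<lambda>p q. disjnt (orthant p) (orthant q)) L \<longleftrightarrow>
      disjoint_family_on (\<lambda>i. orthant (L ! i)) {..<length L}"
  proof
    assume L: "sorted_wrt (\<lambda>p q. disjnt (orthant p) (orthant q)) L"
    show "disjoint_family_on (\<lambda>i. orthant (L ! i)) {..<length L}"
      unfolding disjoint_family_on_def
    proof (intro ballI impI)
      fix i j assume "i \<in> {..<length L}" "j \<in> {..<length L}" "i \<noteq> j"
      then show "orthant (L ! i) \<inter> orthant (L ! j) = {}"
        using sorted_wrt_nth_less[OF L, of i j] sorted_wrt_nth_less[OF L, of j i]
        by (cases i j rule: linorder_cases) (auto simp: disjnt_iff)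
    qed
  qed (auto simp: sorted_wrt_iff_nth_less disjoint_family_on_def disjnt_def)
  moreover have "(\<Union>p\<in>set L. orthant p) = (\<Union>i<length L. orthant (L ! i))"
    by (force simp: set_conv_nth)
  ultimately show ?thesis by (simp add: orthant_partition_def)
qed

text \<open>Each generator is homogeneous and nonzero, hence a scalar multiple of a monomial, and
  the scalar does not affect the space it spans. Recording exponents and variable sets gives the
  partition.\<close>

lemma stanley_decomposition_imp_orthant_partition:
  fixes D :: "(('n, 'k::field) mpoly \<times> 'n set) list"
  assumes D: "stanley_decomposition (*) fine_component (supported_on E) D"
  obtains L where "length L = length D" "orthant_partition L E"
proof -
  have "\<exists>s c. fst p = Poly_Mapping.single s c \<and> c \<noteq> 0" if "p \<in> set D" for p
  proof -
    obtain m Z where p: "p = (m, Z)" by fastforce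
    with D that obtain a where a: "m \<in> fine_component a"
      and inj: "inj_on (\<lambda>f. f * m) (poly_ring_on Z)"
      by (auto simp: stanley_decomposition_def)
    \<comment> \<open>Freeness is used here: if \<open>m\<close> were 0, then 0 and 1 in
      \<open>K[Z]\<close> would have the same multiple of \<open>m\<close>.\<close>
    have "m \<noteq> 0"
    proof
      assume "m = 0"
      moreover have "0 \<in> poly_ring_on Z" "1 \<in> poly_ring_on Z"
        by (auto simp: poly_ring_on_def)
      ultimately have "(0 :: ('n, 'k) mpoly) = 1"
        using inj by (auto dest: inj_onD)
      then show False by simp
    qed
    with a p show ?thesis by (metis fst_conv homogeneous_eq_single)
  qed
  then obtain s c where sc: "\<And>p. p \<in> set D \<Longrightarrow> fst p = Poly_Mapping.single (s p) (c p) \<and> c p \<noteq> 0"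
    by metis
  define L where "L = map (\<lambda>p. (s p, snd p)) D"
  have "stanley_space (*) (D ! i) = supported_on (orthant (L ! i))" if "i < length D" for i
  proof -
    have "D ! i = (Poly_Mapping.single (s (D ! i)) (c (D ! i)), snd (D ! i))" "c (D ! i) \<noteq> 0"
      using sc[of "D ! i"] that by (simp_all add: prod_eq_iff)
    then show ?thesis
      using that stanley_space_single[of "c (D ! i)" "s (D ! i)" "snd (D ! i)"]
      by (metis (no_types, lifting) L_def nth_map)
  qed
  then have "(\<Pi>\<^sub>E i\<in>{..<length D}. stanley_space (*) (D ! i)) =
      (\<Pi>\<^sub>E i\<in>{..<length D}. supported_on (orthant (L ! i)))"
    by (intro PiE_cong) simp
  with D have "orthant_partition L E"
    unfolding orthant_partition_iff_nth
    by (simp add: stanley_decomposition_def bij_betw_sum_supported_on_iff L_def)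
  then show ?thesis
    by (rule that[rotated]) (simp add: L_def)
qed

lemma orthant_partition_imp_stanley_decomposition:
  assumes "orthant_partition L E"
  shows "stanley_decomposition (*) fine_component (supported_on E :: ('n, 'k::field) mpoly set)
    (map (\<lambda>p. (monom (fst p), snd p)) L)"
proof -
  let ?D = "map (\<lambda>p. (monom (fst p), snd p)) L"
  have "stanley_space (*) (?D ! i) = (supported_on (orthant (L ! i)) :: ('n, 'k) mpoly set)"
    if "i < length L" for i
    using that stanley_space_single[of "1::'k" "fst (L ! i)" "snd (L ! i)"] by (simp add: monom_def)
  then have "(\<Pi>\<^sub>E i\<in>{..<length L}. stanley_space (*) (?D ! i)) =
      (\<Pi>\<^sub>E i\<in>{..<length L}. supported_on (orthant (L ! i)) :: ('n, 'k) mpoly set)"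
    by (intro PiE_cong) simp
  \<comment> \<open>The generator must lie in the ideal; its exponent is the base point of its
    orthant, reached with offset 0.\<close>
  moreover have "fst p \<in> E" if "p \<in> set L" for p
  proof -
    have "fst p \<in> orthant p"
      unfolding orthant_def by (rule image_eqI[of _ _ 0]) auto
    then show ?thesis using assms that by (auto simp: orthant_partition_def)
  qed
  ultimately show ?thesis
    using assms bij_betw_sum_supported_on_iff[of "length L" "\<lambda>i. orthant (L ! i)" E, where ?'b = 'k]
    unfolding stanley_decomposition_def orthant_partition_iff_nth
    by (fastforce simp: monom_def supported_on_def
        intro: single_in_fine_component inj_on_subset[OF inj_mult_single])
qed

text \<open>Both infima run over the same lengths. The right-hand side no longer mentions the field,
  so what remains is combinatorics of exponent sets.\<close>

lemma ideal_slength_supported_on: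
  "ideal_slength (supported_on E :: ('n, 'k::field) mpoly set) =
    (INF L \<in> {L. orthant_partition L E}. enat (length L))"
  unfolding slength_def
proof (rule antisym; rule INF_mono)
  fix L assume "L \<in> {L. orthant_partition L E}"
  then show "\<exists>D\<in>{D. stanley_decomposition (*) fine_component (supported_on E :: ('n, 'k) mpoly set) D}.
      enat (length D) \<le> enat (length L)"
    using orthant_partition_imp_stanley_decomposition[of L E, where 'k = 'k]
    by (intro bexI[of _ "map (\<lambda>p. (monom (fst p), snd p)) L"]) simp_all
next
  fix D assume "D \<in> {D. stanley_decomposition (*) fine_component (supported_on E :: ('n, 'k) mpoly set) D}"
  then obtain L where "length L = length D" "orthant_partition L E"
    using stanley_decomposition_imp_orthant_partition by blast
  then show "\<exists>L\<in>{L. orthant_partition L E}. enat (length L) \<le> enat (length D)"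
    by auto
qed

section \<open>Translation of orthants and of partitions\<close>

text \<open>Addition and truncated subtraction of exponents act entrywise, so this form lets
  translations be checked one variable at a time.\<close>

lemma mem_orthant_iff:
  "e \<in> orthant (s, Z) \<longleftrightarrow> (\<forall>i. Poly_Mapping.lookup s i \<le> Poly_Mapping.lookup e i \<and>
    (i \<notin> Z \<longrightarrow> Poly_Mapping.lookup e i = Poly_Mapping.lookup s i))"
  (is "_ \<longleftrightarrow> ?R")
proof
  assume "e \<in> orthant (s, Z)"
  then show ?R by (auto simp: orthant_def lookup_add in_keys_iff)
next
  assume R: ?R
  have "e = s + (e - s)"
    by (rule poly_mapping_eqI) (use R in \<open>simp add: lookup_add lookup_minus\<close>)
  moreover have "Poly_Mapping.keys (e - s) \<subseteq> Z"
    using R by (auto simp: in_keys_iff lookup_minus)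
  ultimately show "e \<in> orthant (s, Z)" by (auto simp: orthant_def)
qed

text \<open>The new base point is the exponent of \<open>x^s / gcd(x^s, x^t)\<close>. In a direction
  of \<open>Z\<close>, truncation is harmless, since the condition is only a lower bound; in the
  other directions the equation needs \<open>t\<close> to be at most \<open>s\<close>, which the
  point \<open>e0\<close> guarantees.\<close>

lemma translate_preimage_orthant:
  assumes "e0 + t \<in> orthant p"
  shows "{e. e + t \<in> orthant p} = orthant (fst p - t, snd p)"
proof -
  obtain s Z where p: "p = (s, Z)" by fastforce
  have *: "Poly_Mapping.lookup t i \<le> Poly_Mapping.lookup s i" if "i \<notin> Z" for i
    using assms that unfolding p mem_orthant_iff lookup_add by (metis le_add2)
  have "e + t \<in> orthant (s, Z) \<longleftrightarrow> e \<in> orthant (s - t, Z)" for e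
    unfolding mem_orthant_iff lookup_add lookup_minus 
    by (intro iff_allI) (use * in fastforce)
  then show ?thesis by (simp add: p)
qed

lemma translate_orthant: "(+) t ` orthant p = orthant (t + fst p, snd p)"
  by (simp add: orthant_def image_image add.assoc)

text \<open>Preimages respect unions and disjointness. The orthants filtered out are those with
  empty preimage, so the list may become shorter, whence an inequality of lengths.\<close>

lemma orthant_partition_preimage:
  assumes "orthant_partition L E"
  obtains L' where "length L' \<le> length L" "orthant_partition L' {e. e + t \<in> E}"
proof
  let ?P = "\<lambda>p. \<exists>e. e + t \<in> orthant p"
  let ?L = "map (\<lambda>p. (fst p - t, snd p)) (filter ?P L)"
  show "length ?L \<le> length L" by simp
  have eq: "orthant (fst p - t, snd p) = {e. e + t \<in> orthant p}" if "?P p" for p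
    using that translate_preimage_orthant by blast
  have "sorted_wrt (\<lambda>p q. disjnt (orthant (fst p - t, snd p)) (orthant (fst q - t, snd q))) (filter ?P L)"
    by (rule sorted_wrt_mono_rel[of _ "\<lambda>p q. disjnt (orthant p) (orthant q)"])
      (use assms in \<open>auto simp: eq disjnt_iff orthant_partition_def intro: sorted_wrt_filter\<close>)
  moreover have "(\<Union>p\<in>set ?L. orthant p) = {e. e + t \<in> E}"
    using assms by (auto simp: orthant_partition_def eq)
  ultimately show "orthant_partition ?L {e. e + t \<in> E}"
    by (simp add: orthant_partition_def sorted_wrt_map)
qed

text \<open>Translation by \<open>t\<close> is injective, so it preserves disjointness, and it maps
  orthants to orthants.\<close>

lemma orthant_partition_translate:
  assumes "orthant_partition L E"
  shows "orthant_partition (map (\<lambda>p. (t + fst p, snd p)) L) ((+) t ` E)"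
proof -
  have "disjnt (orthant (t + fst p, snd p)) (orthant (t + fst q, snd q)) \<longleftrightarrow>
      disjnt (orthant p) (orthant q)" for p q :: "('a \<Rightarrow>\<^sub>0 nat) \<times> 'a set"
    unfolding translate_orthant[symmetric] by (auto simp: disjnt_iff)
  then show ?thesis
    using assms
    by (auto simp: orthant_partition_def sorted_wrt_map translate_orthant[symmetric])
qed

section \<open>Exponent sets of monomial ideals and their colon ideals\<close>

lemma monomial_ideal_eq_supported_on:
  fixes I :: "('n, 'k::field) mpoly set"
  assumes "monomial_ideal I"
  obtains E where "I = supported_on E"
proof -
  obtain A where I: "I = module.span (*) (monom ` A)"
    using assms by (auto simp: monomial_ideal_def)
  interpret M: module "(*) :: ('n, 'k) mpoly \<Rightarrow> _"
    by unfold_locales (simp_all add: algebra_simps)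
  \<comment> \<open>The exponents of all monomials divisible by a generator. The polynomials
    supported there form an ideal containing the generators, hence the span; conversely, each term
    of such a polynomial is a multiple of a generator.\<close>
  define E where "E = {u + a | u a. a \<in> A}"
  have "M.subspace (supported_on E :: ('n, 'k) mpoly set)"
  proof (rule M.subspaceI)
    show "0 \<in> supported_on E" by (simp add: supported_on_def)
  next
    fix f g :: "('n, 'k) mpoly" assume "f \<in> supported_on E" "g \<in> supported_on E"
    then show "f + g \<in> supported_on E"
      using Poly_Mapping.keys_add[of f g] by (auto simp: supported_on_def)
  next
    fix f g :: "('n, 'k) mpoly" assume "g \<in> supported_on E"
    then show "f * g \<in> supported_on E"
      using keys_mult[of f g] by (fastforce simp: supported_on_def E_def add.assoc[symmetric])
  qed
  moreover have "monom ` A \<subseteq> (supported_on E :: ('n, 'k) mpoly set)"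
    by (auto simp: supported_on_def monom_def E_def) (metis add_0)
  ultimately have "I \<subseteq> supported_on E"
    unfolding I by (rule M.span_minimal[rotated])
  moreover have "supported_on E \<subseteq> I"
  proof
    fix f :: "('n, 'k) mpoly" assume f: "f \<in> supported_on E"
    have "Poly_Mapping.single k (Poly_Mapping.lookup f k) \<in> I" if k: "k \<in> Poly_Mapping.keys f" for k
    proof -
      obtain u a where "k = u + a" "a \<in> A" using f k by (auto simp: supported_on_def E_def)
      moreover have "Poly_Mapping.single (u + a) (Poly_Mapping.lookup f k) =
          Poly_Mapping.single u (Poly_Mapping.lookup f k) * monom a"
        by (simp add: monom_def mult_single)
      ultimately show ?thesis
        unfolding I by (metis M.span_base M.span_scale image_eqI)
    qed
    then have "(\<Sum>k\<in>Poly_Mapping.keys f. Poly_Mapping.single k (Poly_Mapping.lookup f k)) \<in> I"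
      unfolding I by (intro M.span_sum)
    then show "f \<in> I" by (simp add: sum_single_lookup)
  qed
  ultimately show ?thesis using that by blast
qed

text \<open>Multiplication by a monomial translates the support by \<open>t\<close> without any
  cancellation.\<close>

lemma colon_ideal_supported_on:
  "colon_ideal (supported_on E :: ('n, 'k::field) mpoly set) (monom t) = supported_on {e. e + t \<in> E}"
  by (auto simp: colon_ideal_def supported_on_def monom_def keys_mult_single)

text \<open>The equality of ideals is tested on the monomials with exponent in \<open>E\<close>:
  comparing supports in a factorization through \<open>monom t\<close> shows that the exponent is a
  translate by \<open>t\<close>.\<close>

lemma supported_on_eq_mult_imp:
  assumes "(supported_on E :: ('n, 'k::field) mpoly set) =
    (\<lambda>f. monom t * f) ` supported_on {e. e + t \<in> E}"
  shows "E = (+) t ` {e. e + t \<in> E}"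
proof (intro equalityI subsetI)
  fix e assume "e \<in> E"
  then have "(monom e :: ('n, 'k) mpoly) \<in> supported_on E"
    by (simp add: supported_on_def monom_def)
  then obtain f :: "('n, 'k) mpoly" where f: "f \<in> supported_on {e. e + t \<in> E}" "monom e = monom t * f"
    using assms by blast
  have "e \<in> Poly_Mapping.keys (f * monom t)"
    using f(2) by (simp add: mult.commute[of f] flip: f(2)) (simp add: monom_def)
  then show "e \<in> (+) t ` {e. e + t \<in> E}"
    using f(1) by (auto simp: monom_def keys_mult_single supported_on_def add.commute)
qed (auto simp: add.commute)

theorem proposition2p4:
  fixes I :: "('n::finite, 'k::field) mpoly set"
    and v :: "('n, 'k) mpoly"
  assumes "monomial_ideal I"
    and "\<exists>t. v = monom t"
  shows "ideal_slength (colon_ideal I v) \<le> ideal_slength I \<and>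
    (I = (\<lambda>f. v * f) ` colon_ideal I v \<longrightarrow>
      ideal_slength (colon_ideal I v) = ideal_slength I)"
proof -
  obtain E where I: "I = supported_on E"
    using assms(1) by (rule monomial_ideal_eq_supported_on)
  obtain t where v: "v = monom t" using assms(2) by blast
  let ?E = "{e. e + t \<in> E}"
  have colon: "colon_ideal I v = supported_on ?E"
    by (simp add: I v colon_ideal_supported_on)
  have le: "ideal_slength (colon_ideal I v) \<le> ideal_slength I"
    unfolding colon unfolding I ideal_slength_supported_on
  proof (rule INF_mono)
    fix L assume "L \<in> {L. orthant_partition L E}"
    then obtain L' where "length L' \<le> length L" "orthant_partition L' ?E"
      using orthant_partition_preimage by blast
    then show "\<exists>L'\<in>{L. orthant_partition L ?E}. enat (length L') \<le> enat (length L)"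
      by auto
  qed
  moreover have "ideal_slength I \<le> ideal_slength (colon_ideal I v)"
    if "I = (\<lambda>f. v * f) ` colon_ideal I v"
  proof -
    \<comment> \<open>In general the translate of \<open>?E\<close> is only the part of
      \<open>E\<close> above \<open>t\<close>; the hypothesis makes it all of \<open>E\<close>, so a
      translated partition of \<open>?E\<close> covers \<open>E\<close>.\<close>
    have E: "E = (+) t ` ?E"
      using that unfolding colon unfolding I v by (rule supported_on_eq_mult_imp)
    show ?thesis
      unfolding colon unfolding I ideal_slength_supported_on
    proof (rule INF_mono)
      fix L assume "L \<in> {L. orthant_partition L ?E}"
      then show "\<exists>L'\<in>{L. orthant_partition L E}. enat (length L') \<le> enat (length L)"
        using orthant_partition_translate[of L ?E t] E[symmetric]
        by (intro bexI[of _ "map (\<lambda>p. (t + fst p, snd p)) L"]) simp_all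
    qed
  qed
  ultimately show ?thesis by (auto intro: antisym)
qed

end
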